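(* For all positive integers $a_1,a_2$, we have \[ f(a_1,a_2)\geq 2\min\{a_1,a_2\}(a_1+a_2)^2; \] and, for all integers $k\geq 3$ and all positive integers $a_1,a_2,\ldots,a_k$, we have \[ f(a_1,a_2,\ldots,a_k)\geq (2\min\{a_1,a_2,\ldots,a_k\}+1)(a_1+a_2+\cdots+a_k)^2. \]
   Context: For an integer $k\geq 2$ and positive integers $a_1,a_2,\ldots,a_k$, $f(a_1,a_2,\ldots,a_k)$ denotes the smallest positive integer $n$ such that every $2$-coloring of $\{1,2,\ldots,n\}$ (i.e. every map from $\{1,\ldots,n\}$ to a set of two colors) has a monochromatic solution to the equation \[ \frac{a_1}{x_1}+\frac{a_2}{x_2}+\cdots+\frac{a_k}{x_k}=\frac{1}{x_{k+1}}, \] that is, there are $x_1,\ldots,x_{k+1}\in\{1,\ldots,n\}$ satisfying the equation and all having the same color; $x_1,\ldots,x_k$ are not necessarily distinct. It is known (Brown–Rödl, Lefmann) that such an $n$ exists, so $f(a_1,\ldots,a_k)$ is well defined. *)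

theory Defs
  imports Complex_Main
begin

text \<open>
  The tuple \<open>(a\<^sub>1, \<dots>, a\<^sub>k)\<close> is the list \<open>a\<close>, so that \<open>k = length a\<close>, and
  \<open>(x\<^sub>1, \<dots>, x\<^sub>k)\<close> and \<open>x\<^sub>k\<^sub>+\<^sub>1\<close> are \<open>x\<close> and \<open>y\<close>. Colorings are total functions, but
  only their values on \<open>{1..n}\<close> matter.
\<close>

definition mono_solution :: "nat list \<Rightarrow> nat \<Rightarrow> (nat \<Rightarrow> bool) \<Rightarrow> bool" where
  "mono_solution a n c \<longleftrightarrow>
     (\<exists>x y. length x = length a \<and> set x \<subseteq> {1..n} \<and> y \<in> {1..n} \<and>
        (\<Sum>i<length a. real (a ! i) / real (x ! i)) = 1 / real y \<and>
        (\<forall>z\<in>set x. c z = c y))"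

text \<open>
  By the theorem of Brown--Roedl and Lefmann the minimum is taken over a nonempty set
  whenever \<open>length a \<ge> 2\<close> and all entries of \<open>a\<close> are positive; outside this range the
  value is irrelevant.
\<close>

definition f :: "nat list \<Rightarrow> nat" where
  "f a = (LEAST n. 0 < n \<and> (\<forall>c :: nat \<Rightarrow> bool. mono_solution a n c))"

end

theory Submission imports Defs begin

text \<open>
  Lower bound: with \<open>m\<close> the least coefficient and \<open>s\<close> the sum of the coefficients, give the
  interval \<open>[q, qs)\<close> one color and its complement in \<open>[1, qs\<^sup>2)\<close> the other, where
  \<open>q = 2m\<close> for \<open>k = 2\<close> and \<open>q = 2m + 1\<close> otherwise. A solution has \<open>y \<le> max x / s\<close> and
  \<open>y \<ge> min x / s\<close>, so it can only have \<open>y < q\<close> and some \<open>x\<^sub>i < q\<close>. Since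
  \<open>my \<le> a\<^sub>i y < x\<^sub>i\<close>, then \<open>y = 1\<close>; two small \<open>x\<^sub>i\<close> would already
  contribute too much, and with a single one the remaining terms add up to less than
  \<open>1/q < 1 - a\<^sub>i/x\<^sub>i\<close>.

  The value \<open>f a\<close> is a minimum over a set that has to be shown nonempty. Replacing \<open>x\<close> by
  \<open>N!/x\<close> and identifying variables, this reduces to the 2-regularity of \<open>ax + by = z\<close>. If
  a coloring \<open>c\<close> had no solution, then \<open>c((a+b)z) \<noteq> c(z)\<close>, so both color classes would be
  closed under means with weights \<open>a : b\<close>. Reflections and means then propagate the color of a
  point just before a color change to (almost) all smaller points of a suitable progression,
  which contains some \<open>z\<close> together with \<open>(a+b)z\<close>.
\<close>

section \<open>Two-regularity of \<open>a * x + b * y = z\<close>\<close>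

lemma linear_two_regular:
  fixes a b :: nat
  assumes "0 < a" "0 < b"
  shows "\<exists>N. \<forall>c :: nat \<Rightarrow> bool. \<exists>x y. 0 < x \<and> 0 < y \<and> a * x + b * y \<le> N \<and>
           c x = c y \<and> c (a * x + b * y) = c x"
proof -
  define g where "g = gcd a b"
  obtain p q where ap: "a = g * p" and bq: "b = g * q" and cop: "coprime p q"
    using gcd_coprime_exists[of a b] assms unfolding g_def by (metis gcd_eq_0_iff mult.commute neq0_conv)
  have g0: "0 < g" and p0: "0 < p" and q0: "0 < q"
    using assms ap bq by auto
  define h where "h = p + q"
  define s where "s = g * h"
  define D where "D = p * q"
  have s_ab: "s = a + b" by (simp add: s_def h_def ap bq algebra_simps)
  have h0: "0 < h" and s2: "2 \<le> s" and D0: "0 < D"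
    using p0 q0 assms by (auto simp: h_def s_ab D_def)
  obtain u v :: int where uv: "u * int p + v * int q = 1"
    using bezout_int[of "int p" "int q"] cop by auto
  \<comment> \<open>\<open>K\<close> bounds the Bezout shifts \<open>t * u\<close> and
    \<open>t * v\<close> for all remainders \<open>t < h\<close>. Indices from \<open>X\<close> on
    stay positive under a shift by \<open>h * K\<close>, and \<open>L\<close> makes room for both
    \<open>X\<close> and \<open>s * X\<close> in \<open>reach\<close>.\<close>
  define K where "K = h * (nat \<bar>u\<bar> + nat \<bar>v\<bar>)"
  define X where "X = h * K + 1"
  define L where "L = s * X + h * (K + 1)"
  define M where "M = D * (s * L + 1) * (q + 1)"
  have L0: "0 < L" using s2 by (simp add: L_def X_def)
  have "\<exists>x y. 0 < x \<and> 0 < y \<and> a * x + b * y \<le> s * M \<and> c x = c y \<and> c (a * x + b * y) = c x"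
    for c :: "nat \<Rightarrow> bool"
  proof (rule ccontr)
    assume "\<not> ?thesis"
    then have H: "c (a * x + b * y) \<noteq> c x"
      if "0 < x" "0 < y" "a * x + b * y \<le> s * M" "c x = c y" for x y
      using that by blast
    have scale: "c (s * z) \<noteq> c z" if "0 < z" "z \<le> M" for z
      using H[of z z] that by (simp add: s_ab distrib_right[symmetric])
    \<comment> \<open>\<open>s * z\<close> avoids the common color of \<open>x\<close> and
      \<open>y\<close> and, by \<open>scale\<close>, that of \<open>z\<close>; with two colors these
      agree. Only \<open>z\<close> is bounded by \<open>M\<close>, so \<open>x\<close> or
      \<open>y\<close> may exceed it.\<close>
    have mean: "c z = c x"
      if "0 < x" "0 < y" "0 < z" "z \<le> M" "p * x + q * y = h * z" "c x = c y" for x y z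
    proof -
      have "a * x + b * y = s * z"
        using that(5) by (simp add: ap bq s_def mult.assoc distrib_left[symmetric])
      then show ?thesis using H[of x y] scale[of z] that by auto
    qed
    have sLM: "D * (s * L + 1) \<le> M" by (simp add: M_def)
    \<comment> \<open>Otherwise \<open>c\<close> is constant on the multiples of \<open>D\<close>
      from \<open>D * L\<close> to \<open>s * (D * L)\<close>, against \<open>scale\<close>.\<close>
    have "\<exists>n. L \<le> n \<and> n < s * L \<and> c (D * n) \<noteq> c (D * (n + 1))"
    proof (rule ccontr)
      assume "\<not> ?thesis"
      then have same: "c (D * n) = c (D * (n + 1))" if "L \<le> n" "n < s * L" for n
        using that by blast
      have "n \<le> s * L \<longrightarrow> c (D * n) = c (D * L)" if "L \<le> n" for n
        using that
      proof (induction rule: dec_induct)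
        case (step n)
        then show ?case using same[of n] by auto
      qed simp
      moreover have Ls: "L \<le> s * L" using s2 by simp
      ultimately have "c (s * (D * L)) = c (D * L)"
        by (metis mult.left_commute order_refl)
      moreover have "D * L \<le> M"
      proof -
        have "D * L \<le> D * (s * L + 1)" using Ls by (intro mult_le_mono2) linarith
        then show ?thesis using sLM by simp
      qed
      ultimately show False using scale[of "D * L"] D0 L0 by simp
    qed
    then obtain n where n: "L \<le> n" "n < s * L" "c (D * n) \<noteq> c (D * (n + 1))" by blast
    define P where "P = D * n"
    define R where "R = D * (n + 1)"
    have RD: "R = P + D" by (simp add: P_def R_def)
    have PR: "c P \<noteq> c R" using n by (simp add: P_def R_def)
    have "R \<le> D * (s * L + 1)" unfolding R_def using n(2) by (intro mult_le_mono2) simp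
    then have RM: "R \<le> M" using sLM by simp
    have P0: "0 < P" using D0 L0 n by (simp add: P_def)
    \<comment> \<open>The color of \<open>R\<close> forces the color opposite to \<open>P\<close> on
      a point above \<open>R\<close>, which in turn forces the color of \<open>P\<close> on the next
      point down.\<close>
    have down: "i * p * h < P \<longrightarrow> c (P - i * p * h) = c P" for i
    proof (induction i)
      case (Suc i)
      show ?case
      proof
        assume lt: "Suc i * p * h < P"
        define V where "V = P - i * p * h"
        define T where "T = P - Suc i * p * h"
        \<comment> \<open>\<open>R\<close> is the weighted mean of \<open>V\<close> and \<open>W\<close>, and \<open>P\<close> that of \<open>T\<close> and \<open>W\<close>.\<close>
        define W where "W = R + q * (q + i * h)"
        have "i * p * h < P" using lt by (simp add: distrib_right)
        then have V: "P = V + i * p * h" "0 < V" "c V = c P"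
          using Suc by (auto simp: V_def)
        have T: "P = T + Suc i * p * h" "0 < T" using lt by (auto simp: T_def)
        have W0: "0 < W" using RD D0 by (simp add: W_def)
        have "p * W + q * V = h * R"
          using V(1) by (simp add: W_def RD D_def h_def algebra_simps)
        then have "c W \<noteq> c V" using mean[of W V R] W0 V PR RM RD D0 by auto
        moreover have "p * W + q * T = h * P"
          using T(1) by (simp add: W_def RD D_def h_def algebra_simps)
        then have "c W = c T \<longrightarrow> c P = c W" using mean[of W T P] W0 T RM RD P0 by auto
        ultimately show "c (P - Suc i * p * h) = c P"
          using V(3) unfolding T_def by blast
      qed
    qed simp
    \<comment> \<open>Taking \<open>q * j\<close> steps at once descends by a multiple of
      \<open>D * h\<close>, so the points remain multiples of \<open>D\<close>.\<close>
    have downD: "c (D * (n - h * j)) = c P" if "h * j < n" for j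
    proof -
      have "q * j * p * h = D * (h * j)" by (simp add: D_def)
      moreover have "D * (h * j) < P" using that D0 by (simp add: P_def)
      ultimately have "c (P - D * (h * j)) = c P" using down[of "q * j"] by metis
      then show ?thesis by (simp add: P_def diff_mult_distrib2)
    qed
    \<comment> \<open>To leave the residue class of \<open>n\<close> modulo \<open>h\<close>, write
      \<open>x\<close> as the weighted mean of \<open>n - h * j\<close> and
      \<open>n - h * j'\<close>. This needs \<open>p * j + q * j' = n - x\<close>, which Bezout
      solves near the quotient \<open>k\<close>; \<open>K \<le> k\<close> keeps both solutions
      nonnegative.\<close>
    have reach: "c (D * x) = c P" if x: "X \<le> x" "x + h * (K + 1) \<le> n" for x
    proof -
      define m where "m = n - x"
      define k where "k = m div h"
      define t where "t = m mod h"
      have m: "m = h * k + t" "t < h" using h0 by (auto simp: k_def t_def)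
      have nm: "n = m + x" using x by (simp add: m_def)
      have Kk: "K \<le> k"
        using x h0 unfolding k_def m_def
        by (subst less_eq_div_iff_mult_less_eq) (auto simp: algebra_simps)
      have tb: "\<bar>int t * w\<bar> \<le> int K" if "w = u \<or> w = v" for w
      proof -
        have "\<bar>int t * w\<bar> \<le> int h * \<bar>w\<bar>" using m(2) by (simp add: abs_mult mult_right_mono)
        also have "\<dots> \<le> int h * (\<bar>u\<bar> + \<bar>v\<bar>)" using that by (intro mult_left_mono) auto
        finally show ?thesis by (simp add: K_def)
      qed
      define j where "j = nat (int k + int t * u)"
      define j' where "j' = nat (int k + int t * v)"
      have j: "int j = int k + int t * u" "j \<le> k + K"
        using tb[of u] Kk by (auto simp: j_def)
      have j': "int j' = int k + int t * v" "j' \<le> k + K"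
        using tb[of v] Kk by (auto simp: j'_def)
      have "int (p * j + q * j') = int h * int k + int t * (u * int p + v * int q)"
        by (simp add: j j' h_def algebra_simps)
      then have pj: "p * j + q * j' = m" unfolding uv m(1) by (simp flip: of_nat_mult of_nat_add)
      have hb: "h * i < n" if "i \<le> k + K" for i
      proof -
        have "h * i \<le> h * k + h * K" using mult_le_mono2[OF that, of h] by (simp add: distrib_left)
        then show ?thesis using nm m x(1) by (simp add: X_def)
      qed
      have hj: "h * j < n" "h * j' < n" using hb j(2) j'(2) by auto
      obtain y where y: "n = h * j + y" "0 < y" using hj(1) less_imp_add_positive by metis
      obtain y' where y': "n = h * j' + y'" "0 < y'" using hj(2) less_imp_add_positive by metis
      have "p * n + q * n = h * (p * j + q * j') + (p * y + q * y')"
        by (subst y(1), subst y'(1)) (simp add: algebra_simps)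
      moreover have "p * n + q * n = h * m + h * x" by (simp add: nm h_def algebra_simps)
      ultimately have "p * y + q * y' = h * x" by (simp add: pj)
      then have eq: "p * (D * y) + q * (D * y') = h * (D * x)"
        by (metis distrib_left mult.left_commute)
      have x0: "0 < x" using x by (simp add: X_def)
      have "D * x \<le> P" using nm by (simp add: P_def)
      then have xM: "D * x \<le> M" using RM RD by simp
      have "c (D * y) = c P" "c (D * y') = c P"
        using downD[OF hj(1)] downD[OF hj(2)] y(1) y'(1) by (metis diff_add_inverse)+
      then show ?thesis
        using mean[OF _ _ _ xM eq] D0 y(2) y'(2) x0 by simp
    qed
    have "X \<le> s * X" using s2 by simp
    then have "X + h * (K + 1) \<le> n" "s * X + h * (K + 1) \<le> n"
      using n(1) unfolding L_def by linarith+
    then have "c (D * X) = c P" "c (D * (s * X)) = c P"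
      using \<open>X \<le> s * X\<close> order_refl[of X] reach[of X] reach[of "s * X"] by blast+
    moreover have "D * X \<le> P"
    proof -
      have "X \<le> n" using n(1) \<open>X \<le> s * X\<close> unfolding L_def by linarith
      then show ?thesis by (simp add: P_def)
    qed
    then have "c (s * (D * X)) \<noteq> c (D * X)"
      using scale[of "D * X"] D0 RM RD by (simp add: X_def)
    ultimately show False by (simp add: mult.left_commute)
  qed
  then show ?thesis by blast
qed

lemma mono_solution_exists:
  assumes len: "2 \<le> length a" and pos: "\<forall>b\<in>set a. 0 < b"
  shows "\<exists>n. 0 < n \<and> (\<forall>c. mono_solution a n c)"
proof -
  obtain a0 as where a: "a = a0 # as" and "as \<noteq> []"
    using len by (cases a) (auto simp: Suc_le_eq)
  then have "0 < a0" "0 < sum_list as"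
    using pos by (auto simp: neq_Nil_conv)
  then obtain N where N: "\<And>c :: nat \<Rightarrow> bool. \<exists>x y. 0 < x \<and> 0 < y \<and>
      a0 * x + sum_list as * y \<le> N \<and> c x = c y \<and> c (a0 * x + sum_list as * y) = c x"
    using linear_two_regular[of a0 "sum_list as"] by blast
  have "mono_solution a (fact N) c" for c
  proof -
    obtain x y where xy: "0 < x" "0 < y" "a0 * x + sum_list as * y \<le> N"
      and col: "c (fact N div x) = c (fact N div y)"
        "c (fact N div (a0 * x + sum_list as * y)) = c (fact N div x)"
      \<comment> \<open>Coloring by reciprocals; the division is exact because \<open>x\<close>,
        \<open>y\<close> and their combination are all at most \<open>N\<close>.\<close>
      using N[of "\<lambda>z. c (fact N div z)"] by blast
    define z where "z = a0 * x + sum_list as * y"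
    have "x \<le> a0 * x" using \<open>0 < a0\<close> by simp
    moreover have "y \<le> sum_list as * y" using \<open>0 < sum_list as\<close> by simp
    ultimately have le: "x \<le> N" "y \<le> N" "z \<le> N" "0 < z"
      using xy unfolding z_def by linarith+
    have dv: "fact N div w \<in> {1..fact N}" "real (fact N div w) = fact N / real w"
      if "0 < w" "w \<le> N" for w
    proof -
      have "w dvd fact N" using that by (simp add: dvd_fact)
      then show "real (fact N div w) = fact N / real w" by (simp add: real_of_nat_div)
      have "w \<le> fact N" using \<open>w dvd fact N\<close> by (simp add: dvd_imp_le)
      then show "fact N div w \<in> {1..fact N}"
        using that by (auto simp: Suc_le_eq div_greater_zero_iff)
    qed
    define xs where "xs = (fact N div x) # replicate (length as) (fact N div y)"
    have "(\<Sum>i<length a. real (a ! i) / real (xs ! i))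
        = real a0 * real x / fact N + (\<Sum>i<length as. real (as ! i) * real y / fact N)"
      using xy le by (simp add: a xs_def sum.lessThan_Suc_shift dv del: sum.lessThan_Suc)
    also have "(\<Sum>i<length as. real (as ! i) * real y / fact N) = real (sum_list as) * real y / fact N"
      by (simp add: sum_list_sum_nth atLeast0LessThan sum_distrib_right sum_divide_distrib)
    finally have "(\<Sum>i<length a. real (a ! i) / real (xs ! i)) = 1 / real (fact N div z)"
      using le by (simp add: dv z_def add_divide_distrib)
    then show ?thesis
      unfolding mono_solution_def using dv xy le col
      by (intro exI[of _ xs] exI[of _ "fact N div z"])
        (auto simp: a xs_def z_def set_replicate_conv_if simp del: One_nat_def)
  qed
  then show ?thesis by (intro exI[of _ "fact N"]) auto
qed

section \<open>A coloring without monochromatic solutions\<close>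

lemma interval_coloring_avoids:
  fixes a :: "nat list" and m q n :: nat
  defines "s \<equiv> sum_list a"
  assumes len: "2 \<le> length a" and m0: "0 < m" and min: "\<forall>b\<in>set a. m \<le> b"
    and q0: "0 < q" and q: "q \<le> 2 * m \<or> 3 \<le> length a \<and> q \<le> 2 * m + 1"
    and n: "n < q * s\<^sup>2"
  shows "\<not> mono_solution a n (\<lambda>z. q \<le> z \<and> z < q * s)"
proof
  let ?k = "length a"
  assume "mono_solution a n (\<lambda>z. q \<le> z \<and> z < q * s)"
  then obtain x y where x: "length x = ?k" "set x \<subseteq> {1..n}" and y: "y \<in> {1..n}"
    and eq: "(\<Sum>i<?k. real (a ! i) / real (x ! i)) = 1 / real y"
    and col: "\<forall>z\<in>set x. (q \<le> z \<and> z < q * s) = (q \<le> y \<and> y < q * s)"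
    unfolding mono_solution_def by blast
  have xi: "1 \<le> x ! i" "x ! i \<le> n" "(q \<le> x ! i \<and> x ! i < q * s) = (q \<le> y \<and> y < q * s)"
    if "i < ?k" for i
  proof -
    have "x ! i \<in> set x" using that x(1) by simp
    then show "1 \<le> x ! i" "x ! i \<le> n" "(q \<le> x ! i \<and> x ! i < q * s) = (q \<le> y \<and> y < q * s)"
      using x(2) col by auto
  qed
  have ai: "m \<le> a ! i" if "i < ?k" for i using min that by simp
  have s: "real s = (\<Sum>i<?k. real (a ! i))"
    by (simp add: s_def sum_list_sum_nth atLeast0LessThan)
  have k0: "0 < ?k" using len by linarith
  have y0: "0 < y" using y by simp
  have "a ! 0 \<le> s" unfolding s_def using k0 by (rule elem_le_sum_list)
  then have s0: "0 < s" using ai[OF k0] m0 by simp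
  have above: "1 / real t < 1 / real y" if "\<And>i. i < ?k \<Longrightarrow> x ! i < t * s" for t
  proof -
    have "t * s > 0" using that[OF k0] by linarith
    have "1 / real t = (\<Sum>i<?k. real (a ! i) / real (t * s))"
      using s0 by (simp add: s sum_divide_distrib[symmetric]) (simp add: s[symmetric])
    also have "\<dots> < (\<Sum>i<?k. real (a ! i) / real (x ! i))"
    proof (rule sum_strict_mono)
      fix i assume "i \<in> {..<?k}"
      then have "x ! i < t * s" "1 \<le> x ! i" "0 < a ! i" using that xi ai[of i] m0 by auto
      then show "real (a ! i) / real (t * s) < real (a ! i) / real (x ! i)"
        using \<open>t * s > 0\<close> by (intro divide_strict_left_mono) (auto simp flip: of_nat_mult)
    qed (use k0 in auto)
    finally show ?thesis by (simp add: eq)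
  qed
  \<comment> \<open>If \<open>y\<close> is in the interval, all \<open>x ! i\<close> are below
    \<open>q * s\<close>, which forces \<open>y < q\<close>. If \<open>y\<close> is beyond it,
    \<open>n < q * s\<^sup>2\<close> forces \<open>y < q * s\<close>.\<close>
  have "y < q"
  proof (rule ccontr)
    assume "\<not> y < q"
    show False
    proof (cases "y < q * s")
      case True
      then have "1 / real q < 1 / real y" using xi \<open>\<not> y < q\<close> by (intro above) auto
      then show False using \<open>\<not> y < q\<close> q0 y0 by (simp add: field_simps)
    next
      case False
      have "x ! i < q * s * s" if "i < ?k" for i
        using xi(2)[OF that] n by (simp add: power2_eq_square mult.assoc)
      then have "1 / real (q * s) < 1 / real y" by (rule above)
      then show False using False q0 s0 y0 by (simp add: field_simps flip: of_nat_mult)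
    qed
  qed
  then have dich: "x ! i < q \<or> q * s \<le> x ! i" if "i < ?k" for i
    using xi(3)[OF that] by auto
  have big: "(\<Sum>i\<in>I. real (a ! i) / real (x ! i)) \<le> (\<Sum>i\<in>I. real (a ! i)) / real (q * s)"
    if "\<And>i. i \<in> I \<Longrightarrow> i < ?k \<and> q * s \<le> x ! i" for I
    unfolding sum_divide_distrib
  proof (rule sum_mono)
    fix i assume "i \<in> I"
    then have "q * s \<le> x ! i" "0 < q * s" "0 < x ! i" using that xi(1) q0 s0 by fastforce+
    then show "real (a ! i) / real (x ! i) \<le> real (a ! i) / real (q * s)"
      by (intro divide_left_mono) (auto simp flip: of_nat_mult)
  qed
  \<comment> \<open>If every \<open>x ! i\<close> were at least \<open>q * s\<close>, the sum would
    be at most \<open>1 / q\<close>, giving \<open>q \<le> y\<close>.\<close>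
  have "\<exists>i<?k. x ! i < q"
  proof (rule ccontr)
    assume "\<not> ?thesis"
    then have "1 / real y \<le> real s / real (q * s)"
      using big[of "{..<?k}"] dich by (auto simp: eq s)
    then show False using \<open>y < q\<close> q0 s0 y0 by (simp add: field_simps)
  qed
  then obtain i where i: "i < ?k" "x ! i < q" by blast
  define r where "r = (\<Sum>j\<in>{..<?k}-{i}. real (a ! j) / real (x ! j))"
  have split: "real (a ! i) / real (x ! i) + r = 1 / real y"
    unfolding r_def eq[symmetric] using i by (simp add: sum.remove[of _ i])
  have term0: "0 < real (a ! j) / real (x ! j)" if "j < ?k" for j
    using xi[OF that] ai[OF that] m0 by auto
  have "{..<?k} - {i} \<noteq> {}"
  proof -
    have "card ({..<?k} - {i}) = ?k - 1" using i by simp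
    then show ?thesis using len by (metis One_nat_def card.empty diff_is_0_eq not_less_eq_eq numeral_2_eq_2)
  qed
  then have r0: "0 < r" unfolding r_def by (intro sum_pos) (auto intro: term0)
  have x0: "0 < x ! i" using xi(1)[OF i(1)] by simp
  have "real (a ! i) / real (x ! i) < 1 / real y" using split r0 by simp
  then have lt: "a ! i * y < x ! i"
    using x0 y0 by (simp add: field_simps flip: of_nat_mult)
  have "m * y \<le> a ! i * y" using ai[OF i(1)] by simp
  then have "m * y < 2 * m" using lt i q by linarith
  then have y1: "y = 1" using y0 by simp
  have others: "q * s \<le> x ! j" if j: "j \<in> {..<?k} - {i}" for j
  proof (rule ccontr)
    assume "\<not> ?thesis"
    then have xj: "x ! j < q" "0 < x ! j" using dich[of j] xi(1)[of j] j by auto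
    have half: "1 / 2 \<le> real (a ! l) / real (x ! l)" if "l < ?k" "x ! l < q" for l
    proof -
      have "x ! l \<le> 2 * (a ! l)" using that(2) ai[OF that(1)] q by linarith
      then have "real (x ! l) \<le> 2 * real (a ! l)" by linarith
      then show ?thesis using xi(1)[OF that(1)] by (simp add: field_simps)
    qed
    \<comment> \<open>Two terms of at least 1/2 leave no room for a third. With only two terms,
      \<open>q \<le> 2 * m\<close> makes the first exceed 1/2; this is why \<open>q\<close> may be
      larger for three or more coefficients.\<close>
    have "real (a ! i) / real (x ! i) + real (a ! j) / real (x ! j) < 1 \<or>
          1 / 2 < real (a ! i) / real (x ! i) \<and> r = real (a ! j) / real (x ! j)"
    proof (cases "{..<?k} - {i} - {j} = {}")
      case True
      then have k: "{..<?k} = {i, j}" using i j by auto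
      have "?k = card {..<?k}" by simp
      also have "\<dots> \<le> 2" unfolding k by (simp add: card_insert_if)
      finally have "q \<le> 2 * m" using q by linarith
      then have "x ! i < 2 * (a ! i)" using i(2) ai[OF i(1)] by linarith
      then have "real (x ! i) < 2 * real (a ! i)" by linarith
      then have "1 / 2 < real (a ! i) / real (x ! i)"
        using x0 by (simp add: field_simps)
      moreover have "{..<?k} - {i} = {j}" using j True by blast
      then have "r = real (a ! j) / real (x ! j)" unfolding r_def by simp
      ultimately show ?thesis by simp
    next
      case False
      then have "0 < (\<Sum>l\<in>{..<?k} - {i} - {j}. real (a ! l) / real (x ! l))"
        by (intro sum_pos) (auto intro: term0)
      then have "real (a ! j) / real (x ! j) < r"
        unfolding r_def using j by (subst sum.remove[of _ j]) auto
      then show ?thesis using split y1 by simp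
    qed
    moreover have "1 / 2 \<le> real (a ! i) / real (x ! i)" using half i .
    moreover have "1 / 2 \<le> real (a ! j) / real (x ! j)" using half[of j] j xj by blast
    moreover have "real (a ! i) / real (x ! i) + r = 1" using split y1 by simp
    ultimately show False by linarith
  qed
  \<comment> \<open>Integrality gives \<open>x ! i - a ! i \<ge> 1\<close>, so \<open>r\<close> is
    at least \<open>1 / x ! i\<close> and exceeds \<open>1 / q\<close>, while the large denominators
    keep it at most \<open>1 / q\<close>.\<close>
  have "r \<le> (\<Sum>j\<in>{..<?k}-{i}. real (a ! j)) / real (q * s)"
    unfolding r_def by (rule big) (use others in auto)
  also have "(\<Sum>j\<in>{..<?k}-{i}. real (a ! j)) = real s - real (a ! i)"
    unfolding s using i by (simp add: sum_diff1)
  also have "(real s - real (a ! i)) / real (q * s) \<le> real s / real (q * s)"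
    by (intro divide_right_mono) auto
  also have "\<dots> = 1 / real q" using s0 by simp
  also have "\<dots> < 1 / real (x ! i)" using i x0 by (simp add: field_simps)
  also have "\<dots> \<le> (real (x ! i) - real (a ! i)) / real (x ! i)"
    using lt y1 by (intro divide_right_mono) auto
  also have "\<dots> = r" using split y1 x0 by (simp add: field_simps)
  finally show False by simp
qed

lemma f_lower_bound:
  assumes len: "2 \<le> length a" and m0: "0 < m" and min: "\<forall>b\<in>set a. m \<le> b"
    and q0: "0 < q" and q: "q \<le> 2 * m \<or> 3 \<le> length a \<and> q \<le> 2 * m + 1"
  shows "q * (sum_list a)\<^sup>2 \<le> f a"
proof (rule ccontr)
  assume "\<not> ?thesis"
  then have "\<not> mono_solution a (f a) (\<lambda>z. q \<le> z \<and> z < q * sum_list a)"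
    using assms by (intro interval_coloring_avoids[of a m]) auto
  moreover have "\<forall>b\<in>set a. 0 < b" using m0 min by force
  \<comment> \<open>The least element has the defining property only because some \<open>n\<close>
    has it.\<close>
  then have "\<forall>c. mono_solution a (f a) c"
    using LeastI_ex[OF mono_solution_exists[OF len]] unfolding f_def by blast
  ultimately show False by blast
qed

theorem theorem1p4:
  "(\<forall>a1 a2 :: nat. 0 < a1 \<and> 0 < a2 \<longrightarrow>
      f [a1, a2] \<ge> 2 * min a1 a2 * (a1 + a2)\<^sup>2) \<and>
   (\<forall>a :: nat list. length a \<ge> 3 \<and> (\<forall>b\<in>set a. 0 < b) \<longrightarrow>
      f a \<ge> (2 * Min (set a) + 1) * (sum_list a)\<^sup>2)"
proof (intro conjI allI impI)
  fix a1 a2 :: nat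
  assume "0 < a1 \<and> 0 < a2"
  then show "f [a1, a2] \<ge> 2 * min a1 a2 * (a1 + a2)\<^sup>2"
    using f_lower_bound[of "[a1, a2]" "min a1 a2" "2 * min a1 a2"] by simp
next
  fix a :: "nat list"
  assume a: "length a \<ge> 3 \<and> (\<forall>b\<in>set a. 0 < b)"
  then have "a \<noteq> []" by auto
  then have "0 < Min (set a)" using a by simp
  then show "f a \<ge> (2 * Min (set a) + 1) * (sum_list a)\<^sup>2"
    using a by (intro f_lower_bound[of a "Min (set a)"]) auto
qed

end
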